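(* Let $\bar{\mathbb{Q}}^{\leftrightarrow}$ be a probability measure on $(\bar\Omega^{\leftrightarrow},\bar{\mathcal{G}}^{\leftrightarrow})$ that is space-time regenerative with regeneration law $\bar{\mathbb{Q}}^{\rightarrow}$, and suppose that $\bar{\mathbb{Q}}^{\rightarrow}\{(\omega,\tilde\omega):\tilde\omega\text{ is discrete}\}=1$. Define $T_1=\bar d_0$ and $T_{n+1}(\bar\omega)=\bar d_{T_n(\bar\omega)}(\bar\omega)$ for $n\in\mathbb{N}$, $\bar\omega=(\omega,\tilde\omega)\in\bar\Omega^{\leftrightarrow}$. For $n\in\mathbb{N}$ define the $\mathbb{R}\cup\{\partial\}$-valued process $Y^n=(Y^n_t)_{t\ge0}$ by $$Y^n_t(\omega,\tilde\omega)=\begin{cases}\omega_{T_n+t}-\omega_{T_n},&0\le t<T_{n+1}-T_n,\\ \partial,&t\ge T_{n+1}-T_n.\end{cases}$$ Then, under $\bar{\mathbb{Q}}^{\leftrightarrow}$, the sequence $(Y^n)_{n\in\mathbb{N}}$ is independent and identically distributed.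
   Context: $\partial$ is an isolated cemetery state adjoined to $\mathbb{R}$. $\Omega^{\leftrightarrow}$ (resp. $\Omega^{\rightarrow}$) is the space of càdlàg real-valued paths indexed by $\mathbb{R}$ (resp. $\mathbb{R}_+$). $\tilde\Omega^{\leftrightarrow}$ (resp. $\tilde\Omega^{\rightarrow}$) is the class of closed subsets of $\mathbb{R}$ (resp. $\mathbb{R}_+$). Put $\bar\Omega^{\leftrightarrow}=\Omega^{\leftrightarrow}\times\tilde\Omega^{\leftrightarrow}$ and $\bar\Omega^{\rightarrow}=\Omega^{\rightarrow}\times\tilde\Omega^{\rightarrow}$. For $t\in\mathbb{R}$: - $\tau_t:\Omega^{\leftrightarrow}\to\Omega^{\rightarrow}$, $(\tau_t(\omega))_s=\omega_{t+s}-\omega_t$, $s\ge0$; - $\tilde\tau_t:\tilde\Omega^{\leftrightarrow}\to\tilde\Omega^{\rightarrow}$, $\tilde\tau_t(\tilde\omega)=\{s-t:s\in\tilde\omega\cap[t,\infty)\}$; - $\bar\tau_t(\omega,\tilde\omega)=(\tau_t(\omega),\tilde\tau_t(\tilde\omega))$; - $\bar d_t(\omega,\tilde\omega)=d_t(\tilde\omega)=\inf\{s>t:s\in\tilde\omega\}\in\mathbb{R}\cup\{+\infty\}$; - $k_t(\omega)$ is the path stopped at $t$: $(k_t(\omega))_s=\omega_s$ for $s\le t$ and $=\omega_t$ for $s>t$ (with $k_{+\infty}(\omega)=\omega$); $k_{\bar d_s}$ denotes $(\omega,\tilde\omega)\mapsto k_{d_s(\tilde\omega)}(\omega)$. $\bar{\mathcal{G}}_t^{\leftrightarrow}=\sigma\{\bar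 d_s,k_{\bar d_s}:s\le t\}$, $\bar{\mathcal{G}}^{\leftrightarrow}=\sigma\{\bar d_s,k_{\bar d_s}:s\in\mathbb{R}\}$, $\bar{\mathcal{G}}^{\leftrightarrow}_{t+}=\bigcap_{\epsilon>0}\bar{\mathcal{G}}^{\leftrightarrow}_{t+\epsilon}$; $\bar{\mathcal{G}}^{\rightarrow}$ on $\bar\Omega^{\rightarrow}$ is defined analogously with time parameter in $\mathbb{R}_+$. $\bar{\mathbb{Q}}^{\leftrightarrow}$ is space-time regenerative with regeneration law $\bar{\mathbb{Q}}^{\rightarrow}$, a probability measure on $(\bar\Omega^{\rightarrow},\bar{\mathcal{G}}^{\rightarrow})$, if (i) $\bar{\mathbb{Q}}^{\leftrightarrow}\{\bar d_t=+\infty\}=0$ for all $t\in\mathbb{R}$; and (ii) for all $t\in\mathbb{R}$ and all nonnegative $\bar{\mathcal{G}}^{\rightarrow}$-measurable $F$, $\bar{\mathbb{Q}}^{\leftrightarrow}[F(\bar\tau_{\bar d_t})\mid\bar{\mathcal{G}}^{\leftrightarrow}_{t+}]=\bar{\mathbb{Q}}^{\rightarrow}[F]$, where $\bar{\mathbb{Q}}^{\leftrightarrow}[\cdot]$ and $\bar{\mathbb{Q}}^{\rightarrow}[\cdot]$ denote expectations. *)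

theory Defs
  imports "HOL-Probability.Probability" "HOL-Analysis.Isolated"
begin

text \<open>The time set \<open>I\<close> is \<open>UNIV\<close> for the two-sided objects and \<open>{0..}\<close> for the one-sided ones.
  A path indexed by \<open>I\<close> is a function that is \<open>undefined\<close> off \<open>I\<close>, so that equal paths are equal
  functions.\<close>

definition cadlag_on :: "real set \<Rightarrow> (real \<Rightarrow> real) \<Rightarrow> bool" where
  "cadlag_on I w \<longleftrightarrow> (\<forall>t\<in>I. (w \<longlongrightarrow> w t) (at t within I \<inter> {t<..}) \<and>
                             (\<exists>l. (w \<longlongrightarrow> l) (at t within I \<inter> {..<t})))"

definition paths :: "real set \<Rightarrow> (real \<Rightarrow> real) set" where
  "paths I = {w \<in> extensional I. cadlag_on I w}"

definition closed_subsets :: "real set \<Rightarrow> real set set" where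
  "closed_subsets I = {A. closed A \<and> A \<subseteq> I}"

definition path_algebra :: "real set \<Rightarrow> (real \<Rightarrow> real) measure" where
  "path_algebra I = restrict_space (PiM I (\<lambda>_. borel)) (paths I)"

type_synonym config = "(real \<Rightarrow> real) \<times> real set"

definition configs :: "real set \<Rightarrow> config set" where
  "configs I = paths I \<times> closed_subsets I"

definition shift_path :: "real \<Rightarrow> (real \<Rightarrow> real) \<Rightarrow> (real \<Rightarrow> real)" where
  "shift_path t w = (\<lambda>s\<in>{0..}. w (t + s) - w t)"

definition shift_set :: "real \<Rightarrow> real set \<Rightarrow> real set" where
  "shift_set t A = (\<lambda>s. s - t) ` (A \<inter> {t..})"

definition shift :: "real \<Rightarrow> config \<Rightarrow> config" where
  "shift t x = (shift_path t (fst x), shift_set t (snd x))"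

text \<open>The argument \<open>t\<close> is extended real so that the iteration \<open>T\<close> below makes sense everywhere;
  the infimum over the empty set is \<open>\<infinity>\<close>, and so is the value at \<open>t = \<infinity>\<close>.\<close>

definition next_point :: "ereal \<Rightarrow> config \<Rightarrow> ereal" where
  "next_point t x = (INF s\<in>{s \<in> snd x. t < ereal s}. ereal s)"

text \<open>Only used for \<open>t > -\<infinity>\<close>.\<close>

definition stop_path :: "ereal \<Rightarrow> (real \<Rightarrow> real) \<Rightarrow> (real \<Rightarrow> real)" where
  "stop_path t w = (\<lambda>s. if ereal s \<le> t then w s else w (real_of_ereal t))"

definition stop_next :: "real \<Rightarrow> config \<Rightarrow> (real \<Rightarrow> real)" where
  "stop_next s x = stop_path (next_point (ereal s) x) (fst x)"

definition config_algebra :: "real set \<Rightarrow> real set \<Rightarrow> config measure" where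
  "config_algebra I J = sigma (configs I)
     ({next_point (ereal s) -` B \<inter> configs I | s B. s \<in> J \<and> B \<in> sets borel} \<union>
      {stop_next s -` B \<inter> configs I | s B. s \<in> J \<and> B \<in> sets (path_algebra I)})"

definition two_sided_algebra :: "config measure" where
  "two_sided_algebra = config_algebra UNIV UNIV"

definition two_sided_filtration :: "real \<Rightarrow> config measure" where
  "two_sided_filtration t = config_algebra UNIV {..t}"

definition two_sided_filtration_right :: "real \<Rightarrow> config measure" where
  "two_sided_filtration_right t =
     sigma (configs UNIV) (\<Inter>e\<in>{0<..}. sets (two_sided_filtration (t + e)))"

definition one_sided_algebra :: "config measure" where
  "one_sided_algebra = config_algebra {0..} {0..}"

text \<open>In the second condition \<open>shift\<close> at \<open>next_point t = \<infinity>\<close> is arbitrary (\<open>real_of_ereal \<infinity> = 0\<close>);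
  by the first condition this concerns a null set only.\<close>

definition space_time_regenerative :: "config measure \<Rightarrow> config measure \<Rightarrow> bool" where
  "space_time_regenerative Q R \<longleftrightarrow>
     prob_space R \<and> sets R = sets one_sided_algebra \<and>
     (\<forall>t::real. measure Q {x \<in> space Q. next_point (ereal t) x = \<infinity>} = 0) \<and>
     (\<forall>t::real. \<forall>F :: config \<Rightarrow> ennreal. F \<in> borel_measurable one_sided_algebra \<longrightarrow>
        (AE x in Q. nn_cond_exp Q (two_sided_filtration_right t)
              (\<lambda>y. F (shift (real_of_ereal (next_point (ereal t) y)) y)) x
            = (\<integral>\<^sup>+ z. F z \<partial>R)))"

text \<open>Starting the recursion from \<open>0\<close> at index \<open>0\<close> makes \<open>T 1\<close> the first point after time \<open>0\<close>.\<close>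

primrec T :: "nat \<Rightarrow> config \<Rightarrow> ereal" where
  "T 0 x = 0"
| "T (Suc n) x = next_point (T n x) x"

text \<open>The state space is \<open>real option\<close>, with \<open>None\<close> as the cemetery. It carries the Borel
  sets of the topology in which \<open>None\<close> is isolated.\<close>

definition cemetery_borel :: "real option measure" where
  "cemetery_borel = sigma UNIV {U. open (Some -` U)}"

definition process_algebra :: "(real \<Rightarrow> real option) measure" where
  "process_algebra = PiM {0..} (\<lambda>_. cemetery_borel)"

text \<open>The condition \<open>t < T (n+1) - T n\<close> is written without subtraction, because
  \<open>\<infinity> - \<infinity> = \<infinity>\<close> in \<^typ>\<open>ereal\<close>.\<close>

definition Y :: "nat \<Rightarrow> config \<Rightarrow> (real \<Rightarrow> real option)" where
  "Y n x = (\<lambda>t\<in>{0..}.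
     if T n x + ereal t < T (Suc n) x
     then Some (fst x (real_of_ereal (T n x) + t) - fst x (real_of_ereal (T n x)))
     else None)"

end

theory Submission
  imports Defs
begin

text \<open>
  The process \<open>Y n\<close> is a fixed functional, the excursion, of the configuration seen from \<open>T n\<close>.
  If \<open>T n\<close> were the first point \<open>d_q\<close> after a deterministic time \<open>q\<close>, regeneration at \<open>q\<close> would say
  at once that \<open>Y n\<close> is independent of the past \<open>G_q\<close> and has the law of the initial excursion under
  \<open>R\<close>. In fact \<open>T n = d_q\<close> for every \<open>q\<close> with \<open>T (n - 1) \<le> q < T n\<close>.

  These intervals are nonempty: under \<open>R\<close> the set is discrete and closed, so points do not accumulate
  at \<open>0\<close>, and regeneration transports this to \<open>Q\<close>: almost surely, for all rational \<open>q\<close>, the point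
  \<open>d_q\<close> is not a limit of later points. Hence \<open>T\<close> is almost surely strictly increasing and finite
  (\<open>AE_T_increasing\<close>), and each interval contains a rational number.

  Cut the space according to the first rational \<open>q\<close>, in a fixed enumeration, that lies in
  \<open>[T (n - 1), T n)\<close>. On such a piece the variables \<open>Y 1, \<dots>, Y (n - 1)\<close> and the piece itself depend
  only on the configuration up to \<open>d_q\<close>. So the intersection of the piece with an event of these
  variables lies in \<open>G_q\<close> (\<open>straddling_event_in_filtration\<close>); regeneration at \<open>q\<close> applies to it, and
  summation over the pieces gives \<open>Y_independent_of_past\<close>. This replaces a strong regeneration
  property at the random times \<open>T n\<close>. Independence follows by induction on the largest index, and the
  common law is that of the initial excursion under \<open>R\<close>.
\<close>

section \<open>Deterministic properties of the next point\<close>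

lemma next_point_less_iff:
  "next_point t x < a \<longleftrightarrow> (\<exists>s\<in>snd x. t < ereal s \<and> ereal s < a)"
  unfolding next_point_def by (auto simp: INF_less_iff)

lemma next_point_ge: "t \<le> next_point t x"
  unfolding next_point_def by (rule INF_greatest) auto

lemma next_point_le: "s \<in> snd x \<Longrightarrow> t < ereal s \<Longrightarrow> next_point t x \<le> ereal s"
  unfolding next_point_def by (rule INF_lower) auto

lemma next_point_greatest:
  "(\<And>s. s \<in> snd x \<Longrightarrow> t < ereal s \<Longrightarrow> a \<le> ereal s) \<Longrightarrow> a \<le> next_point t x"
  unfolding next_point_def by (rule INF_greatest) auto

lemma next_point_mono: "t \<le> u \<Longrightarrow> next_point t x \<le> next_point u x"
  by (rule next_point_greatest) (auto intro: next_point_le)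

text \<open>There is no point strictly between \<open>t\<close> and \<open>next_point t x\<close>.\<close>

lemma next_point_eq_between:
  assumes "t \<le> u" "u < next_point t x"
  shows "next_point u x = next_point t x"
proof (rule antisym)
  show "next_point u x \<le> next_point t x"
  proof (rule next_point_greatest)
    fix s assume "s \<in> snd x" "t < ereal s"
    with assms(2) next_point_le[of s x t] have "u < ereal s" by auto
    with \<open>s \<in> snd x\<close> show "next_point u x \<le> ereal s" by (rule next_point_le)
  qed
qed (rule next_point_mono[OF assms(1)])

lemma next_point_mem:
  assumes "closed (snd x)" "next_point t x = ereal r"
  shows "r \<in> snd x"
proof (rule ccontr)
  assume "r \<notin> snd x"
  then have "open (- snd x)" "r \<in> - snd x" using assms(1) by auto
  then obtain e where e: "e > 0" "ball r e \<subseteq> - snd x" by (rule openE)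
  have "next_point t x < ereal (r + e)" using assms(2) e(1) by simp
  then obtain s where s: "s \<in> snd x" "t < ereal s" "s < r + e"
    by (auto simp: next_point_less_iff)
  with next_point_le[OF s(1,2)] assms(2) have "s \<in> ball r e"
    by (auto simp: dist_real_def)
  with s(1) e(2) show False by blast
qed

lemma next_point_shift:
  "ereal t + next_point (ereal 0) (shift t x) = next_point (ereal t) x"
proof (rule antisym)
  show "ereal t + next_point (ereal 0) (shift t x) \<le> next_point (ereal t) x"
  proof (rule next_point_greatest)
    fix s assume s: "s \<in> snd x" "ereal t < ereal s"
    then have "next_point (ereal 0) (shift t x) \<le> ereal (s - t)"
      by (intro next_point_le) (auto simp: shift_def shift_set_def)
    then have "ereal t + next_point (ereal 0) (shift t x) \<le> ereal t + ereal (s - t)"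
      by (rule add_left_mono)
    then show "ereal t + next_point (ereal 0) (shift t x) \<le> ereal s" by simp
  qed
  have "next_point (ereal t) x - ereal t \<le> next_point (ereal 0) (shift t x)"
  proof (rule next_point_greatest)
    fix u assume u: "u \<in> snd (shift t x)" "ereal 0 < ereal u"
    then have "t + u \<in> snd x" by (auto simp: shift_def shift_set_def)
    then have "next_point (ereal t) x \<le> ereal (t + u)"
      using u(2) by (intro next_point_le) auto
    then show "next_point (ereal t) x - ereal t \<le> ereal u"
      by (cases "next_point (ereal t) x") auto
  qed
  then show "next_point (ereal t) x \<le> ereal t + next_point (ereal 0) (shift t x)"
    by (cases "next_point (ereal t) x"; cases "next_point (ereal 0) (shift t x)") auto
qed

text \<open>An infimum \<open>0\<close> would make \<open>0\<close> a limit of points, hence a point because the set is closed, and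
  then a point that is not isolated.\<close>

lemma discrete_imp_next_point_pos:
  assumes "closed (snd z)" "topological_space_class.discrete (snd z)"
  shows "next_point (ereal 0) z \<noteq> 0"
proof
  assume eq: "next_point (ereal 0) z = 0"
  then have "0 \<in> snd z" using next_point_mem[of z "ereal 0" 0] assms(1) by (simp add: zero_ereal_def)
  then obtain e where e: "e > 0" "\<And>y. y \<in> snd z \<Longrightarrow> dist 0 y < e \<Longrightarrow> y = 0"
    using discreteD[OF assms(2)] unfolding isolated_in_dist_Ex_iff by blast
  have "next_point (ereal 0) z < ereal e" using eq e(1) by simp
  then obtain s where "s \<in> snd z" "0 < s" "s < e"
    unfolding next_point_less_iff by auto
  with e(2)[of s] show False by simp
qed

section \<open>Stopped paths\<close>

lemma stop_path_infinity [simp]: "stop_path \<infinity> w = w"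
  by (simp add: stop_path_def)

lemma stop_path_stop_path:
  "a \<noteq> -\<infinity> \<Longrightarrow> a \<le> b \<Longrightarrow> stop_path a (stop_path b w) = stop_path a w"
proof (cases a)
  case (real r)
  assume "a \<le> b"
  then have "ereal u \<le> b" if "u \<le> r" for u
    using that real by (meson ereal_less_eq(3) order_trans)
  then show ?thesis by (auto simp: stop_path_def fun_eq_iff real)
qed auto

text \<open>The \<open>\<sigma>\<close>-algebra on paths is a trace on the \<open>cadlag\<close> paths, so a stopped path can only be used as a
  measurable map once it is known to stay in that space. For one-sided paths the stopping time must
  not be negative, which the bound by some \<open>s \<in> I\<close> ensures.\<close>

lemma stop_path_in_paths:
  assumes w: "w \<in> paths I" and s: "s \<in> I" "ereal s \<le> a"
    and up: "\<And>u v. u \<in> I \<Longrightarrow> u \<le> v \<Longrightarrow> v \<in> I"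
  shows "stop_path a w \<in> paths I"
proof (cases a)
  case (real t)
  have t: "t \<in> I" using s real up by simp
  define v where "v = stop_path a w"
  have v: "v u = w (min u t)" for u
    by (simp add: v_def stop_path_def real min_def)
  have ext: "v \<in> extensional I"
  proof (unfold extensional_def, clarify)
    fix u assume "u \<notin> I"
    then have "u \<le> t" using up[OF t, of u] by linarith
    with \<open>u \<notin> I\<close> w show "v u = undefined" by (simp add: v paths_def extensional_def)
  qed
  have cad: "cadlag_on I w" using w by (simp add: paths_def)
  have "cadlag_on I v"
    unfolding cadlag_on_def
  proof (intro ballI conjI)
    fix u assume u: "u \<in> I"
    have wr: "(w \<longlongrightarrow> w u) (at u within I \<inter> {u<..})"
      using cad u by (simp add: cadlag_on_def)
    show "(v \<longlongrightarrow> v u) (at u within I \<inter> {u<..})"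
    proof (cases "u < t")
      case True
      have "\<forall>\<^sub>F y in at u within I \<inter> {u<..}. y < t"
        by (rule order_tendstoD(2)[OF tendsto_ident_at True])
      then have "\<forall>\<^sub>F y in at u within I \<inter> {u<..}. w y = v y"
        by eventually_elim (simp add: v)
      moreover have "v u = w u" using True by (simp add: v)
      ultimately show ?thesis using Lim_transform_eventually[OF wr] by simp
    next
      case False
      have "\<forall>\<^sub>F y in at u within I \<inter> {u<..}. w t = v y"
        using False by (auto simp: eventually_at_filter v)
      moreover have "v u = w t" using False by (simp add: v)
      ultimately show ?thesis using Lim_transform_eventually[OF tendsto_const] by simp
    qed
    show "\<exists>l. (v \<longlongrightarrow> l) (at u within I \<inter> {..<u})"
    proof (cases "u \<le> t")
      case True
      obtain l where l: "(w \<longlongrightarrow> l) (at u within I \<inter> {..<u})"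
        using cad u by (auto simp: cadlag_on_def)
      have "\<forall>\<^sub>F y in at u within I \<inter> {..<u}. w y = v y"
        using True by (auto simp: eventually_at_filter v)
      from Lim_transform_eventually[OF l this] show ?thesis by blast
    next
      case False
      then have "t < u" by simp
      have "\<forall>\<^sub>F y in at u within I \<inter> {..<u}. t < y"
        by (rule order_tendstoD(1)[OF tendsto_ident_at \<open>t < u\<close>])
      then have "\<forall>\<^sub>F y in at u within I \<inter> {..<u}. w t = v y"
        by eventually_elim (simp add: v)
      from Lim_transform_eventually[OF tendsto_const this] show ?thesis by blast
    qed
  qed
  with ext show ?thesis by (simp add: paths_def v_def)
qed (use w s in auto)

lemma stop_next_in_paths:
  assumes "x \<in> configs I" "s \<in> I" "\<And>u v. u \<in> I \<Longrightarrow> u \<le> v \<Longrightarrow> v \<in> I"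
  shows "stop_next s x \<in> paths I"
  unfolding stop_next_def
  by (rule stop_path_in_paths[OF _ assms(2) next_point_ge assms(3)])
     (use assms(1) in \<open>auto simp: configs_def\<close>)

section \<open>Measurability of the generators and of the coordinates\<close>

lemma space_config_algebra [simp]: "space (config_algebra I J) = configs I"
  unfolding config_algebra_def by (rule space_measure_of) auto

lemma sets_config_algebra:
  "sets (config_algebra I J) = sigma_sets (configs I)
     ({next_point (ereal s) -` B \<inter> configs I | s B. s \<in> J \<and> B \<in> sets borel} \<union>
      {stop_next s -` B \<inter> configs I | s B. s \<in> J \<and> B \<in> sets (path_algebra I)})"
  unfolding config_algebra_def by (rule sets_measure_of) auto

lemma sets_config_algebra_mono:
  "J \<subseteq> K \<Longrightarrow> sets (config_algebra I J) \<subseteq> sets (config_algebra I K)"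
  unfolding sets_config_algebra by (rule sigma_sets_mono') blast

lemma space_path_algebra [simp]: "space (path_algebra I) = paths I"
  by (auto simp: path_algebra_def space_restrict_space space_PiM PiE_def paths_def)

lemma measurable_next_point:
  "s \<in> J \<Longrightarrow> next_point (ereal s) \<in> borel_measurable (config_algebra I J)"
  by (rule measurableI) (auto simp: sets_config_algebra intro!: sigma_sets.Basic)

lemma measurable_stop_next:
  assumes "s \<in> J" "J \<subseteq> I" "\<And>u v. u \<in> I \<Longrightarrow> u \<le> v \<Longrightarrow> v \<in> I"
  shows "stop_next s \<in> measurable (config_algebra I J) (path_algebra I)"
proof (rule measurableI)
  fix x assume "x \<in> space (config_algebra I J)"
  with assms show "stop_next s x \<in> space (path_algebra I)"
    by (auto intro: stop_next_in_paths)
qed (use assms(1) in \<open>auto simp: sets_config_algebra intro!: sigma_sets.Basic\<close>)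

text \<open>The value \<open>w u\<close> can be read off the path stopped at the first point after \<open>u\<close>, because
  that point is not earlier than \<open>u\<close>.\<close>

lemma measurable_coordinate:
  assumes "u \<in> J" "J \<subseteq> I" "\<And>u v. u \<in> I \<Longrightarrow> u \<le> v \<Longrightarrow> v \<in> I"
  shows "(\<lambda>x. fst x u) \<in> borel_measurable (config_algebra I J)"
proof -
  have "(\<lambda>p. p u) \<in> borel_measurable (path_algebra I)"
    unfolding path_algebra_def using assms(1,2)
    by (intro measurable_restrict_space1 measurable_component_singleton) auto
  from measurable_compose[OF measurable_stop_next[OF assms] this]
  have "(\<lambda>x. stop_next u x u) \<in> borel_measurable (config_algebra I J)" .
  moreover have "stop_next u x u = fst x u" for x
    by (simp add: stop_next_def stop_path_def next_point_ge)
  ultimately show ?thesis by simp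
qed

section \<open>Evaluation at random times\<close>

lemma space_two_sided_algebra [simp]: "space two_sided_algebra = configs UNIV"
  by (simp add: two_sided_algebra_def)

lemma measurable_next_point_two_sided [measurable]:
  "next_point (ereal s) \<in> borel_measurable two_sided_algebra"
  unfolding two_sided_algebra_def by (rule measurable_next_point) simp

lemma measurable_coordinate_two_sided [measurable]:
  "(\<lambda>x. fst x u) \<in> borel_measurable two_sided_algebra"
  unfolding two_sided_algebra_def by (rule measurable_coordinate) auto

text \<open>A point strictly between \<open>\<tau>\<close> and \<open>a\<close> leaves room for a rational number between \<open>\<tau>\<close> and
  it, so deterministic rational start times suffice.\<close>

lemma measurable_next_point_at:
  assumes [measurable]: "\<tau> \<in> borel_measurable two_sided_algebra"
  shows "(\<lambda>x. next_point (\<tau> x) x) \<in> borel_measurable two_sided_algebra"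
proof (rule borel_measurableI_less)
  fix a :: ereal
  have "next_point (\<tau> x) x < a \<longleftrightarrow>
      (\<exists>r\<in>\<rat>. \<tau> x < ereal r \<and> next_point (ereal r) x < a)" for x
  proof
    assume "next_point (\<tau> x) x < a"
    then obtain s where s: "s \<in> snd x" "\<tau> x < ereal s" "ereal s < a"
      by (auto simp: next_point_less_iff)
    obtain r' where r': "\<tau> x < ereal r'" "r' < s"
      using ereal_dense2[OF s(2)] by auto
    obtain r where r: "r \<in> \<rat>" "r' < r" "r < s"
      using Rats_dense_in_real[OF r'(2)] by auto
    have "\<tau> x < ereal r" using r'(1) r(2) by (meson ereal_less_eq(3) less_imp_le order_less_le_trans)
    moreover have "next_point (ereal r) x < a"
      using s r unfolding next_point_less_iff by auto
    ultimately show "\<exists>r\<in>\<rat>. \<tau> x < ereal r \<and> next_point (ereal r) x < a"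
      using r(1) by blast
  next
    assume "\<exists>r\<in>\<rat>. \<tau> x < ereal r \<and> next_point (ereal r) x < a"
    then show "next_point (\<tau> x) x < a"
      using next_point_mono[of "\<tau> x" _ x] by (meson less_imp_le order_le_less_trans)
  qed
  then have "{x \<in> space two_sided_algebra. next_point (\<tau> x) x < a} =
    (\<Union>r\<in>\<rat>. {x \<in> space two_sided_algebra. \<tau> x < ereal r \<and> next_point (ereal r) x < a})"
    by blast
  also have "\<dots> \<in> sets two_sided_algebra"
  proof (rule sets.countable_UN''[OF countable_rat])
    fix r
    show "{x \<in> space two_sided_algebra. \<tau> x < ereal r \<and> next_point (ereal r) x < a}
        \<in> sets two_sided_algebra"
      by measurable
  qed
  finally show "{x \<in> space two_sided_algebra. next_point (\<tau> x) x < a} \<in> sets two_sided_algebra" .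
qed

lemma filterlim_grid_at_right:
  "filterlim (\<lambda>k. (of_int \<lfloor>real (Suc k) * r\<rfloor> + 1) / real (Suc k)) (at_right r) sequentially"
proof -
  define g where "g k = (of_int \<lfloor>real (Suc k) * r\<rfloor> + 1) / real (Suc k)" for k
  have above: "r < g k" for k
  proof -
    have "real (Suc k) * r < of_int \<lfloor>real (Suc k) * r\<rfloor> + 1" by linarith
    then show "r < g k" unfolding g_def by (simp add: field_simps del: of_nat_Suc)
  qed
  have below: "g k \<le> r + 1 / real (Suc k)" for k
  proof -
    have "of_int \<lfloor>real (Suc k) * r\<rfloor> + 1 \<le> real (Suc k) * r + 1" by linarith
    then have "g k \<le> (real (Suc k) * r + 1) / real (Suc k)"
      unfolding g_def by (rule divide_right_mono) simp
    then show ?thesis by (simp add: add_divide_distrib del: of_nat_Suc)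
  qed
  have upper: "(\<lambda>k. r + 1 / real (Suc k)) \<longlonglongrightarrow> r"
    using tendsto_add[OF tendsto_const LIMSEQ_Suc[OF lim_1_over_n], of r] by simp
  have "g \<longlonglongrightarrow> r"
  proof (rule tendsto_sandwich[OF _ _ tendsto_const upper])
    show "\<forall>\<^sub>F k in sequentially. r \<le> g k" by (simp add: above less_imp_le)
    show "\<forall>\<^sub>F k in sequentially. g k \<le> r + 1 / real (Suc k)"
      by (rule always_eventually, rule allI, rule below)
  qed
  then have "filterlim g (at_right r) sequentially"
    using above by (auto simp: filterlim_at less_imp_neq[symmetric] intro!: always_eventually)
  then show ?thesis unfolding g_def .
qed

text \<open>Right continuity: \<open>\<tau>\<close> is the limit, strictly from the right, of times with countably many
  values.\<close>

lemma measurable_path_at: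
  assumes [measurable]: "\<tau> \<in> borel_measurable two_sided_algebra"
  shows "(\<lambda>x. fst x (\<tau> x :: real)) \<in> borel_measurable two_sided_algebra"
proof (rule borel_measurable_LIMSEQ_metric)
  fix k
  have "(\<lambda>x. (\<lambda>i x. fst x ((of_int i + 1) / real (Suc k))) \<lfloor>real (Suc k) * \<tau> x\<rfloor> x)
      \<in> borel_measurable two_sided_algebra"
    by (rule measurable_compose_countable) measurable
  then show "(\<lambda>x. fst x ((of_int \<lfloor>real (Suc k) * \<tau> x\<rfloor> + 1) / real (Suc k)))
      \<in> borel_measurable two_sided_algebra" .
next
  fix x assume "x \<in> space two_sided_algebra"
  then have "cadlag_on UNIV (fst x)"
    by (auto simp: configs_def paths_def)
  then have "(fst x \<longlongrightarrow> fst x (\<tau> x)) (at_right (\<tau> x))"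
    by (simp add: cadlag_on_def)
  from filterlim_compose[OF this filterlim_grid_at_right]
  show "(\<lambda>k. fst x ((of_int \<lfloor>real (Suc k) * \<tau> x\<rfloor> + 1) / real (Suc k)))
      \<longlonglongrightarrow> fst x (\<tau> x)" .
qed

section \<open>Excursions\<close>

text \<open>The same functional serves for the two-sided configuration at the times \<open>T n\<close> and for the
  one-sided configuration at time \<open>0\<close>; it commutes with the shift.\<close>

definition excursion :: "ereal \<Rightarrow> config \<Rightarrow> real \<Rightarrow> real option" where
  "excursion t x = (\<lambda>u\<in>{0..}.
     if t + ereal u < next_point t x
     then Some (fst x (real_of_ereal t + u) - fst x (real_of_ereal t)) else None)"

lemma Y_eq_excursion: "Y n x = excursion (T n x) x"
  by (simp add: Y_def excursion_def)

lemma excursion_shift: "excursion (ereal 0) (shift t x) = excursion (ereal t) x"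
proof -
  have "ereal u < next_point (ereal 0) (shift t x) \<longleftrightarrow> ereal t + ereal u < next_point (ereal t) x" for u
    unfolding next_point_shift[symmetric, of t x]
    by (cases "next_point (ereal 0) (shift t x)") auto
  then show ?thesis
    by (auto simp: excursion_def shift_def shift_path_def fun_eq_iff restrict_def zero_ereal_def[symmetric])
qed

lemma measurable_Some_cemetery:
  assumes [measurable]: "f \<in> borel_measurable M" "Measurable.pred M P"
  shows "(\<lambda>x. if P x then Some (f x :: real) else None) \<in> measurable M cemetery_borel"
  unfolding cemetery_borel_def
proof (rule measurable_measure_of)
  fix U :: "real option set" assume "U \<in> {U. open (Some -` U)}"
  then have [measurable]: "Some -` U \<in> sets borel" by (auto intro: borel_open)
  have "(\<lambda>x. if P x then Some (f x) else None) -` U \<inter> space M =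
    {x \<in> space M. (P x \<and> f x \<in> Some -` U) \<or> (\<not> P x \<and> None \<in> U)}"
    by (auto split: if_splits)
  also have "\<dots> \<in> sets M" by measurable
  finally show "(\<lambda>x. if P x then Some (f x) else None) -` U \<inter> space M \<in> sets M" .
qed auto

lemma measurable_excursion_at:
  assumes [measurable]: "\<tau> \<in> borel_measurable two_sided_algebra"
  shows "(\<lambda>x. excursion (\<tau> x) x) \<in> measurable two_sided_algebra process_algebra"
proof -
  have [measurable]: "(\<lambda>x. next_point (\<tau> x) x) \<in> borel_measurable two_sided_algebra"
    by (rule measurable_next_point_at) measurable
  have [measurable]: "(\<lambda>x. fst x (real_of_ereal (\<tau> x) + u)) \<in> borel_measurable two_sided_algebra" for u
    by (rule measurable_path_at) measurable
  have [measurable]: "(\<lambda>x. fst x (real_of_ereal (\<tau> x))) \<in> borel_measurable two_sided_algebra"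
    by (rule measurable_path_at) measurable
  show ?thesis
    unfolding excursion_def process_algebra_def
    by (intro measurable_restrict measurable_Some_cemetery) measurable
qed

lemma measurable_excursion_one_sided:
  "excursion (ereal 0) \<in> measurable one_sided_algebra process_algebra"
proof -
  have [measurable]: "next_point (ereal 0) \<in> borel_measurable one_sided_algebra"
    unfolding one_sided_algebra_def by (rule measurable_next_point) simp
  have c: "(\<lambda>x. fst x u) \<in> borel_measurable one_sided_algebra" if "0 \<le> u" for u
    unfolding one_sided_algebra_def by (rule measurable_coordinate) (use that in auto)
  have "(\<lambda>x. excursion (ereal 0) x) \<in> measurable one_sided_algebra process_algebra"
    unfolding excursion_def process_algebra_def
    by (intro measurable_restrict measurable_Some_cemetery borel_measurable_diff c) auto
  then show ?thesis by simp
qed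

lemma measurable_T [measurable]: "T n \<in> borel_measurable two_sided_algebra"
proof (induction n)
  case 0
  have "T 0 = (\<lambda>_. 0)" by (simp add: fun_eq_iff)
  then show ?case by (simp only: borel_measurable_const)
next
  case (Suc n)
  have "T (Suc n) = (\<lambda>x. next_point (T n x) x)" by (simp add: fun_eq_iff)
  with measurable_next_point_at[OF Suc] show ?case by (simp only:)
qed

lemma measurable_Y: "Y n \<in> measurable two_sided_algebra process_algebra"
proof -
  have "Y n = (\<lambda>x. excursion (T n x) x)" by (simp add: fun_eq_iff Y_eq_excursion)
  with measurable_excursion_at[OF measurable_T] show ?thesis by (simp only:)
qed

section \<open>Truncation after the first point following a fixed time\<close>

text \<open>Truncation is measurable from the past \<open>G_q\<close> to the full \<open>\<sigma>\<close>-algebra. Hence an event that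
  does not notice truncation at \<open>q\<close> belongs to \<open>G_q\<close>, and no generator of \<open>G_q\<close> has to be exhibited
  for it.\<close>

definition truncate_config :: "real \<Rightarrow> config \<Rightarrow> config" where
  "truncate_config q x = (stop_next q x, {s \<in> snd x. ereal s \<le> next_point (ereal q) x})"

text \<open>Truncation keeps the point \<open>d_q\<close> itself, so a start time before \<open>d_q\<close> still finds its next point,
  while from \<open>d_q\<close> on nothing is left.\<close>

lemma next_point_truncate:
  assumes "closed (snd x)"
  shows "next_point t (truncate_config q x) =
    (if t < next_point (ereal q) x then next_point t x else \<infinity>)"
proof (cases "t < next_point (ereal q) x")
  case True
  have "next_point t (truncate_config q x) = next_point t x"
  proof (rule antisym)
    show "next_point t x \<le> next_point t (truncate_config q x)"
      by (rule next_point_greatest) (auto simp: truncate_config_def intro: next_point_le)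
    show "next_point t (truncate_config q x) \<le> next_point t x"
    proof (rule next_point_greatest)
      fix s assume s: "s \<in> snd x" "t < ereal s"
      show "next_point t (truncate_config q x) \<le> ereal s"
      proof (cases "ereal s \<le> next_point (ereal q) x")
        case True
        with s show ?thesis by (intro next_point_le) (auto simp: truncate_config_def)
      next
        case False
        \<comment> \<open>The first point after \<open>q\<close> is then finite, belongs to the closed set, and survives
            truncation.\<close>
        then obtain d where d: "next_point (ereal q) x = ereal d"
          using next_point_ge[of "ereal q" x] by (cases "next_point (ereal q) x") auto
        have "next_point t (truncate_config q x) \<le> ereal d"
          using True d next_point_mem[OF assms d]
          by (intro next_point_le) (auto simp: truncate_config_def)
        also have "\<dots> \<le> ereal s" using False d by simp
        finally show ?thesis .
      qed
    qed
  qed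
  with True show ?thesis by simp
next
  case False
  have "next_point t (truncate_config q x) = \<infinity>"
    using False unfolding next_point_def truncate_config_def
    by (auto simp: top_ereal_def[symmetric] intro!: INF_eqI)
  with False show ?thesis by simp
qed

text \<open>The right side is a generator of \<open>G_q\<close>, so measurability of truncation needs no path regularity.\<close>

lemma stop_next_truncate:
  assumes "closed (snd x)"
  shows "stop_next s (truncate_config q x) = stop_next (min s q) x"
proof -
  let ?d = "next_point (ereal q) x"
  have ninf: "next_point (ereal u) x \<noteq> -\<infinity>" for u
    using next_point_ge[of "ereal u" x] by auto
  have eq: "stop_next s (truncate_config q x) =
      stop_path (if ereal s < ?d then next_point (ereal s) x else \<infinity>) (stop_path ?d (fst x))"
    unfolding next_point_truncate[OF assms, symmetric]
    by (simp add: stop_next_def truncate_config_def)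
  have q: "ereal q \<le> ?d" by (rule next_point_ge)
  consider "s < q" | "q \<le> s" "ereal s < ?d" | "q \<le> s" "?d \<le> ereal s" by fastforce
  then show ?thesis
  proof cases
    case 1
    then have "ereal s < ?d" using q by (metis ereal_less(2) less_ereal.simps(1) order_less_le_trans)
    moreover have "next_point (ereal s) x \<le> ?d" using 1 by (intro next_point_mono) simp
    ultimately show ?thesis using 1 ninf
      unfolding eq by (simp add: stop_next_def stop_path_stop_path)
  next
    case 2
    then have "next_point (ereal s) x = ?d" by (intro next_point_eq_between) auto
    with 2 ninf show ?thesis
      unfolding eq by (simp add: stop_next_def stop_path_stop_path)
  next
    case 3
    then have "\<not> ereal s < ?d" by simp
    with 3 show ?thesis
      unfolding eq by (simp add: stop_next_def)
  qed
qed

lemma closed_snd: "x \<in> configs I \<Longrightarrow> closed (snd x)"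
  by (auto simp: configs_def closed_subsets_def)

lemma truncate_in_configs:
  assumes "x \<in> configs UNIV"
  shows "truncate_config q x \<in> configs UNIV"
proof -
  have "stop_next q x \<in> paths UNIV"
    by (rule stop_next_in_paths[OF assms]) auto
  moreover have "closed {s \<in> snd x. ereal s \<le> next_point (ereal q) x}"
  proof -
    have "closed {s. ereal s \<le> next_point (ereal q) x}"
      by (intro closed_Collect_le continuous_intros continuous_on_ereal)
    from closed_Int[OF closed_snd[OF assms] this] show ?thesis
      by (simp add: Int_def)
  qed
  ultimately show ?thesis
    by (simp add: configs_def truncate_config_def closed_subsets_def)
qed

lemma measurable_truncate:
  "truncate_config q \<in> measurable (two_sided_filtration q) two_sided_algebra"
proof -
  let ?G = "two_sided_filtration q"
  have space: "space ?G = configs UNIV" by (simp add: two_sided_filtration_def)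
  have np [measurable]: "next_point (ereal s) \<in> borel_measurable ?G" if "s \<le> q" for s
    unfolding two_sided_filtration_def by (rule measurable_next_point) (use that in auto)
  have next_trunc: "(\<lambda>x. next_point (ereal s) (truncate_config q x)) \<in> borel_measurable ?G" for s
  proof -
    have eq: "next_point (ereal s) (truncate_config q x) =
        (if ereal s < next_point (ereal q) x then next_point (ereal (min s q)) x else \<infinity>)"
      if "x \<in> space ?G" for x
    proof -
      have "next_point (ereal s) x = next_point (ereal (min s q)) x"
        if "ereal s < next_point (ereal q) x"
        using that next_point_eq_between[of "ereal q" "ereal s" x]
        by (cases "s \<le> q") (auto simp: min_def)
      with that show ?thesis
        by (simp add: next_point_truncate closed_snd space)
    qed
    have [measurable]: "next_point (ereal q) \<in> borel_measurable ?G"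
      "next_point (ereal (min s q)) \<in> borel_measurable ?G"
      by (rule np[OF order_refl], rule np[OF min.cobounded2])
    have "(\<lambda>x. if ereal s < next_point (ereal q) x then next_point (ereal (min s q)) x
        else \<infinity>) \<in> borel_measurable ?G"
      by measurable
    then show ?thesis by (subst measurable_cong[OF eq])
  qed
  have stop_trunc: "(\<lambda>x. stop_next s (truncate_config q x)) \<in> measurable ?G (path_algebra UNIV)" for s
  proof -
    have "stop_next (min s q) \<in> measurable ?G (path_algebra UNIV)"
      unfolding two_sided_filtration_def by (rule measurable_stop_next) auto
    then show ?thesis
      by (subst measurable_cong[where g = "stop_next (min s q)"])
         (simp_all add: stop_next_truncate closed_snd space)
  qed
  show ?thesis
    unfolding two_sided_algebra_def
  proof (rule measurable_sigma_sets[OF sets_config_algebra])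
    show "truncate_config q \<in> space ?G \<rightarrow> configs UNIV"
      using truncate_in_configs by (auto simp: space)
    have pre: "truncate_config q -` (f -` B \<inter> configs UNIV) \<inter> space ?G =
        (\<lambda>x. f (truncate_config q x)) -` B \<inter> space ?G" for f :: "config \<Rightarrow> 'z" and B
      using truncate_in_configs by (auto simp: space)
    fix A
    assume "A \<in> {next_point (ereal s) -` B \<inter> configs UNIV | s B. s \<in> UNIV \<and> B \<in> sets borel} \<union>
      {stop_next s -` B \<inter> configs UNIV | s B. s \<in> UNIV \<and> B \<in> sets (path_algebra UNIV)}"
    then show "truncate_config q -` A \<inter> space ?G \<in> sets ?G"
    proof (elim UnE CollectE exE conjE)
      fix s B assume "A = next_point (ereal s) -` B \<inter> configs UNIV" "B \<in> sets borel"
      then show ?thesis by (simp only: pre measurable_sets[OF next_trunc])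
    next
      fix s B assume "A = stop_next s -` B \<inter> configs UNIV" "B \<in> sets (path_algebra UNIV)"
      then show ?thesis by (simp only: pre measurable_sets[OF stop_trunc])
    qed
  qed auto
qed

section \<open>Fixed times inside an excursion interval\<close>

definition straddles :: "nat \<Rightarrow> real \<Rightarrow> config \<Rightarrow> bool" where
  "straddles m q x \<longleftrightarrow> T m x \<le> ereal q \<and> ereal q < T (Suc m) x"

lemma T_mono: "i \<le> j \<Longrightarrow> T i x \<le> T j x"
  by (rule lift_Suc_mono_le) (simp_all add: next_point_ge)

lemma T_nonneg: "0 \<le> T i x"
  using T_mono[of 0 i x] by simp

lemma exists_rational_straddle:
  assumes "T m x < T (Suc m) x"
  shows "\<exists>q\<in>\<rat>. straddles m q x"
proof -
  obtain p where p: "T m x < ereal p" "ereal p < T (Suc m) x"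
    using ereal_dense2[OF assms] by blast
  obtain p' where p': "ereal p < ereal p'" "ereal p' < T (Suc m) x"
    using ereal_dense2[OF p(2)] by blast
  then obtain q where "q \<in> \<rat>" "p < q" "q < p'"
    using Rats_dense_in_real[of p p'] by auto
  then show ?thesis
    using p p' unfolding straddles_def
    by (meson ereal_less_eq(3) less_imp_le order_le_less_trans order_less_le_trans)
qed

lemma straddles_next_point: "straddles m q x \<Longrightarrow> next_point (ereal q) x = T (Suc m) x"
  by (auto simp: straddles_def intro: next_point_eq_between)

lemma measurable_straddles [measurable]: "Measurable.pred two_sided_algebra (straddles m q)"
  unfolding straddles_def by measurable

text \<open>Until the times \<open>T i\<close> pass \<open>q\<close> they are computed from points that truncation keeps. The
  assumption excludes the case of \<open>q\<close> being a limit of later points, where truncation would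
  create an infinite gap after \<open>q\<close>.\<close>

lemma T_truncate:
  assumes "closed (snd x)" "ereal q < next_point (ereal q) x"
  shows "T i (truncate_config q x) = T i x \<or>
    (ereal q < T i (truncate_config q x) \<and> ereal q < T i x)"
proof (induction i)
  case (Suc i)
  show ?case
  proof (cases "T i (truncate_config q x) = T i x \<and> T i x \<le> ereal q")
    case True
    then have "T i x < next_point (ereal q) x" using assms(2) by auto
    with True show ?thesis by (simp add: next_point_truncate[OF assms(1)])
  next
    case False
    with Suc have "ereal q < T i (truncate_config q x)" "ereal q < T i x" by auto
    then show ?thesis using T_mono[of i "Suc i"] by (metis le_SucI order.refl order_less_le_trans)
  qed
qed simp

lemma straddles_truncate_imp:
  assumes "closed (snd x)" "ereal q < next_point (ereal q) x"
    and "T m x \<le> ereal q \<or> T m (truncate_config q x) \<le> ereal q" "i \<le> Suc m"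
  shows "T i (truncate_config q x) = T i x"
proof -
  have le: "T i (truncate_config q x) = T i x" if "i \<le> m" for i
    using T_truncate[OF assms(1,2), of i] T_mono[OF that, of x]
      T_mono[OF that, of "truncate_config q x"] assms(3) by auto
  moreover have "T (Suc m) (truncate_config q x) = T (Suc m) x"
  proof -
    have "T m x < next_point (ereal q) x"
      using assms(2,3) le[of m] by auto
    then show ?thesis
      by (simp add: le next_point_truncate[OF assms(1)])
  qed
  ultimately show ?thesis using assms(4) by (cases "i = Suc m") auto
qed

lemma straddles_truncate_iff:
  assumes "closed (snd x)" "ereal q < next_point (ereal q) x"
  shows "straddles m q (truncate_config q x) \<longleftrightarrow> straddles m q x"
  using straddles_truncate_imp[OF assms, of m m] straddles_truncate_imp[OF assms, of m "Suc m"]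
  unfolding straddles_def by auto

lemma straddles_gap: "straddles m q x \<Longrightarrow> ereal q < next_point (ereal q) x"
  using straddles_next_point by (auto simp: straddles_def)

lemma T_truncate_straddles:
  assumes "closed (snd x)" "straddles m q x" "i \<le> Suc m"
  shows "T i (truncate_config q x) = T i x"
  using straddles_truncate_imp[OF assms(1) straddles_gap[OF assms(2)] _ assms(3)] assms(2)
  by (auto simp: straddles_def)

text \<open>The processes with index at most \<open>m\<close> end at or before \<open>T (m + 1) = d_q\<close>, and up to there truncation
  changes neither the path nor the times.\<close>

lemma Y_truncate_straddles:
  assumes cl: "closed (snd x)" and m: "straddles m q x" and i: "i \<le> m"
  shows "Y i (truncate_config q x) = Y i x"
proof -
  have T: "T i (truncate_config q x) = T i x" "T (Suc i) (truncate_config q x) = T (Suc i) x"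
    using T_truncate_straddles[OF cl m, of i] T_truncate_straddles[OF cl m, of "Suc i"] i
    by (simp_all del: T.simps)
  have "T i x \<le> ereal q" using T_mono[OF i, of x] m by (auto simp: straddles_def)
  then obtain r where r: "T i x = ereal r" using T_nonneg[of i x] by (cases "T i x") auto
  have "fst (truncate_config q x) u = fst x u" if "ereal u \<le> T (Suc i) x" for u
  proof -
    have "ereal u \<le> next_point (ereal q) x"
      using that T_mono[of "Suc i" "Suc m" x] i straddles_next_point[OF m] by auto
    then show ?thesis by (simp add: truncate_config_def stop_next_def stop_path_def)
  qed
  moreover have "ereal r \<le> T (Suc i) x" using r T_mono[of i "Suc i" x] by simp
  ultimately show ?thesis unfolding Y_def T r by (auto simp: fun_eq_iff)
qed

text \<open>Such an event is its own preimage under truncation, cut down to \<open>d_q > q\<close>. The cut is needed because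
  truncation can turn a configuration with \<open>d_q = q\<close> into one that straddles.\<close>

lemma straddling_event_in_filtration:
  assumes C: "C \<in> sets two_sided_algebra"
    and straddle: "\<And>x. x \<in> C \<Longrightarrow> straddles m q x"
    and inv: "\<And>x. x \<in> configs UNIV \<Longrightarrow> straddles m q x \<Longrightarrow> truncate_config q x \<in> C \<longleftrightarrow> x \<in> C"
  shows "C \<in> sets (two_sided_filtration q)"
proof -
  let ?G = "two_sided_filtration q"
  have space: "space ?G = configs UNIV" by (simp add: two_sided_filtration_def)
  have [measurable]: "next_point (ereal q) \<in> borel_measurable ?G"
    unfolding two_sided_filtration_def by (rule measurable_next_point) simp
  have sub: "C \<subseteq> configs UNIV" using sets.sets_into_space[OF C] by simp
  have "C = truncate_config q -` C \<inter> space ?G \<inter> {x \<in> space ?G. ereal q < next_point (ereal q) x}"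
  proof (intro equalityI subsetI)
    fix x assume x: "x \<in> C"
    then have c: "x \<in> configs UNIV" and st: "straddles m q x" using sub straddle by auto
    show "x \<in> truncate_config q -` C \<inter> space ?G \<inter> {x \<in> space ?G. ereal q < next_point (ereal q) x}"
      using x c inv[OF c st] straddles_gap[OF st] by (simp add: space)
  next
    fix x assume "x \<in> truncate_config q -` C \<inter> space ?G \<inter> {x \<in> space ?G. ereal q < next_point (ereal q) x}"
    then have x: "x \<in> configs UNIV" "truncate_config q x \<in> C" "ereal q < next_point (ereal q) x"
      by (auto simp: space)
    with straddle have "straddles m q x"
      using straddles_truncate_iff[OF closed_snd[OF x(1)] x(3)] by blast
    with inv x show "x \<in> C" by blast
  qed
  also have "\<dots> \<in> sets ?G"
    by (intro sets.Int measurable_sets[OF measurable_truncate C]) measurable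
  finally show ?thesis .
qed

section \<open>Consequences of the regeneration property\<close>

context
  fixes Q R :: "config measure"
  assumes prob_Q: "prob_space Q" and sets_Q: "sets Q = sets two_sided_algebra"
    and regen: "space_time_regenerative Q R"
begin

interpretation Q: prob_space Q by (rule prob_Q)

interpretation R: prob_space R using regen by (simp add: space_time_regenerative_def)

lemma space_Q: "space Q = configs UNIV"
  using sets_eq_imp_space_eq[OF sets_Q] by simp

lemma sets_R: "sets R = sets one_sided_algebra"
  using regen by (simp add: space_time_regenerative_def)

lemma space_R: "space R = configs {0..}"
  using sets_eq_imp_space_eq[OF sets_R] by (simp add: one_sided_algebra_def)

lemma sets_filtration_right:
  "sets (two_sided_filtration_right t) =
    sigma_sets (configs UNIV) (\<Inter>e\<in>{0<..}. sets (two_sided_filtration (t + e)))"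
proof -
  have "(\<Inter>e\<in>{0<..}. sets (two_sided_filtration (t + e))) \<subseteq> sets (two_sided_filtration (t + 1))"
    by force
  also have "\<dots> \<subseteq> Pow (configs UNIV)"
    using sets.space_closed[of "two_sided_filtration (t + 1)"] by (simp add: two_sided_filtration_def)
  finally show ?thesis
    unfolding two_sided_filtration_right_def by (rule sets_measure_of)
qed

lemma filtration_subset_right:
  "sets (two_sided_filtration t) \<subseteq> sets (two_sided_filtration_right t)"
proof -
  have "sets (two_sided_filtration t) \<subseteq> sets (two_sided_filtration (t + e))" if "e > 0" for e
    unfolding two_sided_filtration_def using that by (intro sets_config_algebra_mono) auto
  then have "sets (two_sided_filtration t) \<subseteq> (\<Inter>e\<in>{0<..}. sets (two_sided_filtration (t + e)))"
    by blast
  then show ?thesis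
    unfolding sets_filtration_right by (blast intro: sigma_sets.Basic)
qed

lemma subalgebra_filtration_right: "subalgebra Q (two_sided_filtration_right t)"
proof -
  have "(\<Inter>e\<in>{0<..}. sets (two_sided_filtration (t + e))) \<subseteq> sets (two_sided_filtration (t + 1))"
    by force
  also have "\<dots> \<subseteq> sets Q"
    unfolding sets_Q two_sided_algebra_def two_sided_filtration_def
    by (rule sets_config_algebra_mono) simp
  finally have sub: "sets (two_sided_filtration_right t) \<subseteq> sets Q"
    unfolding sets_filtration_right space_Q[symmetric] by (rule sets.sigma_sets_subset)
  have "space (two_sided_filtration_right t) = configs UNIV"
    unfolding two_sided_filtration_right_def by (rule space_measure_of_conv)
  with sub show ?thesis by (simp add: subalgebra_def space_Q)
qed

lemma filtration_subset: "sets (two_sided_filtration t) \<subseteq> sets Q"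
  using filtration_subset_right[of t] subalgebra_filtration_right[of t]
  by (auto simp: subalgebra_def)

lemma regeneration_on_event:
  assumes F: "F \<in> borel_measurable one_sided_algebra"
    and FS: "(\<lambda>x. F (shift (real_of_ereal (next_point (ereal q) x)) x)) \<in> borel_measurable Q"
    and B: "B \<in> sets (two_sided_filtration q)"
  shows "(\<integral>\<^sup>+x. indicator B x * F (shift (real_of_ereal (next_point (ereal q) x)) x) \<partial>Q) =
    emeasure Q B * (\<integral>\<^sup>+z. F z \<partial>R)"
proof -
  let ?G = "two_sided_filtration_right q"
  let ?f = "\<lambda>x. F (shift (real_of_ereal (next_point (ereal q) x)) x)"
  interpret finite_measure_subalgebra Q ?G
    by unfold_locales (rule subalgebra_filtration_right)
  have B': "B \<in> sets ?G" using B filtration_subset_right by blast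
  have BQ: "B \<in> sets Q" using B filtration_subset by blast
  have "(\<integral>\<^sup>+x. indicator B x * ?f x \<partial>Q) = (\<integral>\<^sup>+x. indicator B x * nn_cond_exp Q ?G ?f x \<partial>Q)"
    by (rule nn_cond_exp_intg[OF _ FS, symmetric]) (use B' in simp)
  also have "\<dots> = (\<integral>\<^sup>+x. (\<integral>\<^sup>+z. F z \<partial>R) * indicator B x \<partial>Q)"
  proof (rule nn_integral_cong_AE)
    have "AE x in Q. nn_cond_exp Q ?G ?f x = (\<integral>\<^sup>+z. F z \<partial>R)"
      using regen F by (simp add: space_time_regenerative_def)
    then show "AE x in Q. indicator B x * nn_cond_exp Q ?G ?f x = (\<integral>\<^sup>+z. F z \<partial>R) * indicator B x"
      by eventually_elim (simp add: mult.commute)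
  qed
  also have "\<dots> = (\<integral>\<^sup>+z. F z \<partial>R) * emeasure Q B"
    by (rule nn_integral_cmult_indicator[OF BQ])
  finally show ?thesis by (simp add: mult.commute)
qed

text \<open>The detour through \<open>real_of_ereal\<close> keeps the shift in the regeneration property meaningful on the
  null set where there is no point after \<open>q\<close>.\<close>

lemma excursion_regeneration:
  assumes A: "A \<in> sets process_algebra" and B: "B \<in> sets (two_sided_filtration q)"
  shows "emeasure Q {x \<in> B. excursion (ereal (real_of_ereal (next_point (ereal q) x))) x \<in> A} =
    emeasure Q B * emeasure R {z \<in> space R. excursion (ereal 0) z \<in> A}"
proof -
  let ?e = "\<lambda>x. excursion (ereal (real_of_ereal (next_point (ereal q) x))) x"
  have BQ [measurable]: "B \<in> sets Q"
    using B filtration_subset by blast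
  have e: "?e \<in> measurable two_sided_algebra process_algebra"
    by (rule measurable_excursion_at) measurable
  have eQ [measurable]: "?e \<in> measurable Q process_algebra"
    using e by (simp cong: measurable_cong_sets add: sets_Q)
  have e0: "excursion (ereal 0) \<in> measurable R process_algebra"
    using measurable_excursion_one_sided by (simp cong: measurable_cong_sets add: sets_R)
  note [measurable] = A
  have "emeasure Q {x \<in> B. ?e x \<in> A} = (\<integral>\<^sup>+x. indicator {x \<in> B. ?e x \<in> A} x \<partial>Q)"
  proof (rule nn_integral_indicator[symmetric])
    have "{x \<in> space Q. x \<in> B \<and> ?e x \<in> A} \<in> sets Q" by measurable
    moreover have "{x \<in> B. ?e x \<in> A} = {x \<in> space Q. x \<in> B \<and> ?e x \<in> A}"
      using sets.sets_into_space[OF BQ] by auto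
    ultimately show "{x \<in> B. ?e x \<in> A} \<in> sets Q" by simp
  qed
  also have "\<dots> = (\<integral>\<^sup>+x. indicator B x * indicator A (excursion (ereal 0)
      (shift (real_of_ereal (next_point (ereal q) x)) x)) \<partial>Q)"
    by (rule nn_integral_cong) (simp add: excursion_shift indicator_def)
  also have "\<dots> = emeasure Q B * (\<integral>\<^sup>+z. indicator A (excursion (ereal 0) z) \<partial>R)"
  proof (rule regeneration_on_event[OF _ _ B])
    show "(\<lambda>z. indicator A (excursion (ereal 0) z)) \<in> borel_measurable one_sided_algebra"
      by (rule measurable_compose[OF measurable_excursion_one_sided]) (use A in simp)
    show "(\<lambda>x. indicator A (excursion (ereal 0)
      (shift (real_of_ereal (next_point (ereal q) x)) x)) :: ennreal) \<in> borel_measurable Q"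
      unfolding excursion_shift by measurable
  qed
  also have "(\<integral>\<^sup>+z. indicator A (excursion (ereal 0) z) \<partial>R) =
      (\<integral>\<^sup>+z. indicator {z \<in> space R. excursion (ereal 0) z \<in> A} z \<partial>R)"
    by (rule nn_integral_cong) (simp add: indicator_def)
  also have "\<dots> = emeasure R {z \<in> space R. excursion (ereal 0) z \<in> A}"
    using measurable_sets[OF e0 A]
    by (intro nn_integral_indicator) (simp add: vimage_def Int_def conj_commute)
  finally show ?thesis .
qed

lemma AE_next_point_finite: "AE x in Q. next_point (ereal q) x \<noteq> \<infinity>"
proof -
  have [measurable]: "next_point (ereal q) \<in> borel_measurable Q"
    using measurable_next_point_two_sided by (simp cong: measurable_cong_sets add: sets_Q)
  have "measure Q {x \<in> space Q. next_point (ereal q) x = \<infinity>} = 0"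
    using regen by (simp add: space_time_regenerative_def)
  then have "emeasure Q {x \<in> space Q. next_point (ereal q) x = \<infinity>} = 0"
    by (simp add: Q.emeasure_eq_measure)
  then show ?thesis
    by (subst AE_iff_measurable[OF _ refl]) auto
qed

context
  assumes discrete_R:
    "measure R {x \<in> space R. topological_space_class.discrete (snd x)} = 1"
begin

lemma AE_R_next_point_pos: "AE z in R. next_point (ereal 0) z \<noteq> 0"
proof -
  have "{x \<in> space R. topological_space_class.discrete (snd x)} \<in> sets R"
    using discrete_R measure_notin_sets by force
  then have "AE z in R. topological_space_class.discrete (snd z)"
    using R.prob_Collect_eq_1[of "\<lambda>z. topological_space_class.discrete (snd z)"] discrete_R by simp
  with AE_space show ?thesis
    by eventually_elim (rule discrete_imp_next_point_pos, auto simp: space_R intro: closed_snd)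
qed

text \<open>The law of the shifted configuration charges only sets without an accumulation of points at
  \<open>0\<close>, so no point that comes first after a fixed time is a limit of later points.\<close>

lemma AE_next_point_isolated:
  "AE x in Q. next_point (ereal (real_of_ereal (next_point (ereal q) x))) x \<noteq>
    ereal (real_of_ereal (next_point (ereal q) x))"
proof -
  let ?d = "\<lambda>x. real_of_ereal (next_point (ereal q) x)"
  have eq: "next_point (ereal 0) (shift t x) = 0 \<longleftrightarrow> next_point (ereal t) x = ereal t" for t x
    unfolding next_point_shift[symmetric, of t x]
    by (cases "next_point (ereal 0) (shift t x)") auto
  have "(\<lambda>x. next_point (ereal (?d x)) x) \<in> borel_measurable two_sided_algebra"
    by (rule measurable_next_point_at) measurable
  then have [measurable]: "(\<lambda>x. next_point (ereal (?d x)) x) \<in> borel_measurable Q"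
    by (simp cong: measurable_cong_sets add: sets_Q)
  have [measurable]: "next_point (ereal q) \<in> borel_measurable Q"
    using measurable_next_point_two_sided by (simp cong: measurable_cong_sets add: sets_Q)
  have [measurable]: "next_point (ereal 0) \<in> borel_measurable one_sided_algebra"
    unfolding one_sided_algebra_def by (rule measurable_next_point) simp
  let ?F = "\<lambda>z. indicator {0} (next_point (ereal 0) z) :: ennreal"
  have F: "?F (shift (?d x) x) = indicator {x. next_point (ereal (?d x)) x = ereal (?d x)} x" for x
    by (simp add: indicator_def eq)
  have meas: "(\<lambda>x. ?F (shift (?d x) x)) \<in> borel_measurable Q"
    unfolding F by measurable
  have UN: "configs UNIV \<in> sets (two_sided_filtration q)"
    using sets.top[of "two_sided_filtration q"] by (simp add: two_sided_filtration_def)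
  have "(\<integral>\<^sup>+x. indicator (configs UNIV) x * ?F (shift (?d x) x) \<partial>Q) =
      emeasure Q (configs UNIV) * (\<integral>\<^sup>+z. ?F z \<partial>R)"
    by (rule regeneration_on_event[OF _ meas UN]) measurable
  also have "(\<integral>\<^sup>+z. ?F z \<partial>R) = (\<integral>\<^sup>+z. 0 \<partial>R)"
    by (rule nn_integral_cong_AE) (use AE_R_next_point_pos in \<open>auto simp: indicator_def\<close>)
  finally have "(\<integral>\<^sup>+x. indicator (configs UNIV) x * ?F (shift (?d x) x) \<partial>Q) = 0" by simp
  moreover have "(\<integral>\<^sup>+x. ?F (shift (?d x) x) \<partial>Q) =
      (\<integral>\<^sup>+x. indicator (configs UNIV) x * ?F (shift (?d x) x) \<partial>Q)"
    by (rule nn_integral_cong) (simp add: space_Q)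
  ultimately have "(\<integral>\<^sup>+x. ?F (shift (?d x) x) \<partial>Q) = 0" by simp
  then have "AE x in Q. ?F (shift (?d x) x) = 0"
    by (simp only: nn_integral_0_iff_AE[OF meas])
  then show ?thesis
    unfolding F by (auto simp: indicator_def split: if_splits)
qed

text \<open>Every \<open>T (m + 1)\<close> is the first point after some rational time, so the almost sure properties of
  those countably many points propagate along the recursion.\<close>

lemma AE_T_increasing: "AE x in Q. \<forall>m. T m x < T (Suc m) x \<and> T (Suc m) x \<noteq> \<infinity>"
proof -
  let ?d = "\<lambda>q x. next_point (ereal q) x"
  let ?P = "\<lambda>q x. ?d q x \<noteq> \<infinity> \<and>
    next_point (ereal (real_of_ereal (?d q x))) x \<noteq> ereal (real_of_ereal (?d q x))"
  have "AE x in Q. \<forall>q\<in>\<rat>. ?P q x"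
    unfolding AE_ball_countable[OF countable_rat]
    using AE_next_point_finite AE_next_point_isolated by (auto intro: AE_conjI)
  then show ?thesis
  proof eventually_elim
    case (elim x)
    have step: "?d q x < next_point (?d q x) x \<and> next_point (?d q x) x \<noteq> \<infinity>" if q: "q \<in> \<rat>" for q
    proof -
      obtain r where r: "?d q x = ereal r"
        using elim q next_point_ge[of "ereal q" x] by (cases "?d q x") auto
      have "next_point (ereal r) x \<noteq> ereal r" using elim[rule_format, OF q] r by simp
      with next_point_ge[of "ereal r" x] have "ereal r < next_point (ereal r) x" by simp
      moreover obtain p where p: "p \<in> \<rat>" "r < p" using Rats_dense_in_real[of r "r + 1"] by auto
      have "next_point (ereal r) x \<le> ?d p x" using p by (intro next_point_mono) simp
      then have "next_point (ereal r) x \<noteq> \<infinity>" using elim p(1) by auto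
      ultimately show ?thesis by (simp add: r)
    qed
    have "T m x < T (Suc m) x \<and> T (Suc m) x \<noteq> \<infinity>" for m
    proof (induction m)
      case 0
      have "next_point 0 x \<noteq> 0" using step[of 0] by (auto simp: zero_ereal_def[symmetric])
      moreover have "next_point 0 x \<noteq> \<infinity>" using elim[rule_format, of 0] by (simp add: zero_ereal_def)
      ultimately show ?case using next_point_ge[of 0 x] by (simp add: order_less_le)
    next
      case (Suc m)
      then obtain q where "q \<in> \<rat>" "straddles m q x" using exists_rational_straddle by blast
      then show ?case using step[of q] straddles_next_point[of m q x] by simp
    qed
    then show ?case by blast
  qed
qed

text \<open>The times \<open>T m\<close> and \<open>T (m + 1)\<close> are random, but almost surely some rational number lies between
  them. Cutting along the first rational number, in a fixed enumeration, that lies in the interval before \<open>T (m + 1)\<close>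
  reduces the claim to regeneration at fixed times.\<close>

lemma Y_independent_of_past:
  assumes C: "C \<in> sets Q" and A: "A \<in> sets process_algebra"
    and inv: "\<And>q x. x \<in> configs UNIV \<Longrightarrow> straddles m q x \<Longrightarrow> truncate_config q x \<in> C \<longleftrightarrow> x \<in> C"
  shows "emeasure Q {x \<in> C. Y (Suc m) x \<in> A} =
    emeasure Q C * emeasure R {z \<in> space R. excursion (ereal 0) z \<in> A}"
proof -
  let ?r = "emeasure R {z \<in> space R. excursion (ereal 0) z \<in> A}"
  define \<rho> where "\<rho> = from_nat_into (\<rat> :: real set)"
  have range_\<rho>: "range \<rho> = \<rat>"
    unfolding \<rho>_def by (rule range_from_nat_into) (auto simp: countable_rat)
  define E where "E i = {x \<in> C. straddles m (\<rho> i) x \<and> (\<forall>l<i. \<not> straddles m (\<rho> l) x)}" for i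
  have sub: "C \<subseteq> configs UNIV" using sets.sets_into_space[OF C] by (simp add: space_Q)
  have C2 [measurable]: "C \<in> sets two_sided_algebra" using C by (simp add: sets_Q)
  have E2: "E i \<in> sets two_sided_algebra" for i
  proof -
    have "{x \<in> space two_sided_algebra. x \<in> C \<and> straddles m (\<rho> i) x \<and>
        (\<forall>l\<in>{..<i}. \<not> straddles m (\<rho> l) x)} \<in> sets two_sided_algebra"
      by measurable
    also have "{x \<in> space two_sided_algebra. x \<in> C \<and> straddles m (\<rho> i) x \<and>
        (\<forall>l\<in>{..<i}. \<not> straddles m (\<rho> l) x)} = E i"
      using sub by (auto simp: E_def)
    finally show ?thesis .
  qed
  then have EQ: "E i \<in> sets Q" for i by (simp add: sets_Q)
  have EG: "E i \<in> sets (two_sided_filtration (\<rho> i))" for i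
  proof (rule straddling_event_in_filtration[OF E2])
    fix x assume "x \<in> E i" then show "straddles m (\<rho> i) x" by (simp add: E_def)
  next
    fix x assume x: "x \<in> configs UNIV" "straddles m (\<rho> i) x"
    have "straddles m p (truncate_config (\<rho> i) x) \<longleftrightarrow> straddles m p x" for p
      using T_truncate_straddles[OF closed_snd[OF x(1)] x(2), of m]
        T_truncate_straddles[OF closed_snd[OF x(1)] x(2), of "Suc m"]
      by (simp add: straddles_def del: T.simps)
    with inv[OF x] show "truncate_config (\<rho> i) x \<in> E i \<longleftrightarrow> x \<in> E i"
      by (simp add: E_def)
  qed
  have YQ: "{x \<in> D. Y (Suc m) x \<in> A} \<in> sets Q" if D: "D \<in> sets Q" for D
  proof -
    have "Y (Suc m) -` A \<inter> space Q \<in> sets Q"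
      using measurable_sets[OF measurable_Y A] by (simp add: sets_Q space_Q)
    moreover have "{x \<in> D. Y (Suc m) x \<in> A} = D \<inter> (Y (Suc m) -` A \<inter> space Q)"
      using sets.sets_into_space[OF D] by auto
    ultimately show ?thesis using D by simp
  qed
  have piece: "emeasure Q {x \<in> E i. Y (Suc m) x \<in> A} = emeasure Q (E i) * ?r" for i
  proof -
    let ?e = "\<lambda>x. excursion (ereal (real_of_ereal (next_point (ereal (\<rho> i)) x))) x"
    have e: "?e \<in> measurable two_sided_algebra process_algebra"
      by (rule measurable_excursion_at) measurable
    have "E i \<inter> (?e -` A \<inter> space two_sided_algebra) \<in> sets Q"
      using EQ measurable_sets[OF e A] by (simp add: sets_Q)
    also have "E i \<inter> (?e -` A \<inter> space two_sided_algebra) = {x \<in> E i. ?e x \<in> A}"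
      using sets.sets_into_space[OF EQ[of i]] by (auto simp: space_Q)
    finally have meas: "{x \<in> E i. ?e x \<in> A} \<in> sets Q" .
    have "emeasure Q {x \<in> E i. Y (Suc m) x \<in> A} = emeasure Q {x \<in> E i. ?e x \<in> A}"
    proof (rule emeasure_eq_AE[OF _ YQ[OF EQ] meas])
      show "AE x in Q. x \<in> {x \<in> E i. Y (Suc m) x \<in> A} \<longleftrightarrow> x \<in> {x \<in> E i. ?e x \<in> A}"
        using AE_next_point_finite[of "\<rho> i"]
      proof eventually_elim
        case (elim x)
        have "?e x = Y (Suc m) x" if "x \<in> E i"
        proof -
          have eq: "next_point (ereal (\<rho> i)) x = T (Suc m) x"
            using that by (intro straddles_next_point) (simp add: E_def)
          then have "ereal (real_of_ereal (next_point (ereal (\<rho> i)) x)) = T (Suc m) x"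
            using elim T_nonneg[of "Suc m" x] by (cases "T (Suc m) x") auto
          then show ?thesis by (simp only: Y_eq_excursion)
        qed
        then show ?case by auto
      qed
    qed
    also have "\<dots> = emeasure Q (E i) * ?r" by (rule excursion_regeneration[OF A EG])
    finally show ?thesis .
  qed
  have disj: "disjoint_family E"
    unfolding disjoint_family_on_def E_def by auto (metis linorder_neqE_nat)
  have cover: "AE x in Q. x \<in> C \<longleftrightarrow> x \<in> (\<Union>i. E i)"
    using AE_T_increasing
  proof eventually_elim
    case (elim x)
    have "x \<in> (\<Union>i. E i)" if "x \<in> C"
    proof -
      obtain q where "q \<in> \<rat>" "straddles m q x"
        using exists_rational_straddle[of m x] elim by blast
      then have ex: "\<exists>i. straddles m (\<rho> i) x" using range_\<rho> by (metis rangeE)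
      have "x \<in> E (LEAST i. straddles m (\<rho> i) x)"
        using that LeastI_ex[OF ex] not_less_Least by (auto simp: E_def)
      then show ?thesis by blast
    qed
    then show ?case by (auto simp: E_def)
  qed
  have "emeasure Q {x \<in> C. Y (Suc m) x \<in> A} = emeasure Q (\<Union>i. {x \<in> E i. Y (Suc m) x \<in> A})"
    using cover by (intro emeasure_eq_AE YQ C sets.countable_UN) (auto intro!: YQ EQ)
  also have "\<dots> = (\<Sum>i. emeasure Q {x \<in> E i. Y (Suc m) x \<in> A})"
    using disj by (intro suminf_emeasure[symmetric])
      (auto intro!: YQ EQ simp: disjoint_family_on_def)
  also have "\<dots> = (\<Sum>i. emeasure Q (E i)) * ?r"
    by (simp only: piece ennreal_suminf_multc)
  also have "(\<Sum>i. emeasure Q (E i)) = emeasure Q (\<Union>i. E i)"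
    using EQ by (intro suminf_emeasure disj) auto
  also have "\<dots> = emeasure Q C"
    using cover EQ C by (intro emeasure_eq_AE) auto
  finally show ?thesis .
qed

lemma law_Y:
  assumes A: "A \<in> sets process_algebra"
  shows "emeasure Q {x \<in> space Q. Y (Suc m) x \<in> A} =
    emeasure R {z \<in> space R. excursion (ereal 0) z \<in> A}"
  using Y_independent_of_past[OF sets.top A, of m] truncate_in_configs
  by (simp add: Q.emeasure_space_1) (simp add: space_Q)

lemma measurable_Y_Q: "Y n \<in> measurable Q process_algebra"
  using measurable_Y by (simp cong: measurable_cong_sets add: sets_Q)

text \<open>Peeling off the largest index \<open>n = m + 1\<close> leaves an event of processes with index at most \<open>m\<close>,
  which truncation at a straddling time does not affect.\<close>

lemma prob_Y_product:
  assumes "finite J" "J \<subseteq> {1..}" "\<And>j. j \<in> J \<Longrightarrow> A j \<in> sets process_algebra"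
  shows "Q.prob {x \<in> space Q. \<forall>j\<in>J. Y j x \<in> A j} =
    (\<Prod>j\<in>J. Q.prob {x \<in> space Q. Y j x \<in> A j})"
  using assms
proof (induction J rule: finite_linorder_max_induct)
  case empty
  then show ?case by (simp add: Q.prob_space)
next
  case (insert n J)
  then obtain m where n: "n = Suc m" by (cases n) auto
  let ?C = "{x \<in> space Q. \<forall>j\<in>J. Y j x \<in> A j}"
  have A: "A n \<in> sets process_algebra" using insert.prems by simp
  have C: "?C \<in> sets Q"
  proof -
    have "{x \<in> space Q. Y j x \<in> A j} \<in> sets Q" if "j \<in> J" for j
      using measurable_sets[OF measurable_Y_Q, of "A j" j] insert.prems(2)[of j] that
      by (simp add: vimage_def Int_def conj_commute)
    with insert.hyps(1) show ?thesis by (intro sets.sets_Collect_finite_All) auto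
  qed
  have inv: "truncate_config q x \<in> ?C \<longleftrightarrow> x \<in> ?C"
    if x: "x \<in> configs UNIV" and st: "straddles m q x" for q x
  proof -
    have "Y j (truncate_config q x) = Y j x" if "j \<in> J" for j
      using insert.hyps(2) that n by (intro Y_truncate_straddles[OF closed_snd[OF x] st]) auto
    then show ?thesis using x truncate_in_configs[OF x] by (simp add: space_Q)
  qed
  have "emeasure Q {x \<in> ?C. Y n x \<in> A n} = emeasure Q ?C * emeasure Q {x \<in> space Q. Y n x \<in> A n}"
    unfolding n law_Y[OF A[unfolded n]] by (rule Y_independent_of_past[OF C A[unfolded n] inv])
  then have "Q.prob {x \<in> ?C. Y n x \<in> A n} = Q.prob ?C * Q.prob {x \<in> space Q. Y n x \<in> A n}"
    by (simp add: measure_def enn2real_mult)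
  moreover have "{x \<in> space Q. \<forall>j\<in>insert n J. Y j x \<in> A j} = {x \<in> ?C. Y n x \<in> A n}" by auto
  moreover have "n \<notin> J" using insert.hyps(2) by blast
  ultimately show ?case using insert by simp
qed

lemma indep_vars_Y: "Q.indep_vars (\<lambda>_. process_algebra) Y {1..}"
  unfolding Q.indep_vars_def2
proof (intro conjI ballI Q.indep_setsI)
  fix j show "Q.random_variable process_algebra (Y j)" by (rule measurable_Y_Q)
  show "{Y j -` B \<inter> space Q | B. B \<in> sets process_algebra} \<subseteq> Q.events"
    using measurable_sets[OF measurable_Y_Q] by auto
next
  fix B J assume J: "J \<noteq> {}" "J \<subseteq> {1::nat..}" "finite J"
    and B: "\<forall>j\<in>J. B j \<in> {Y j -` A \<inter> space Q | A. A \<in> sets process_algebra}"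
  then obtain A where A: "\<And>j. j \<in> J \<Longrightarrow> B j = Y j -` A j \<inter> space Q"
      "\<And>j. j \<in> J \<Longrightarrow> A j \<in> sets process_algebra"
    by (simp only: mem_Collect_eq bchoice_iff) blast
  obtain i where "i \<in> J" using J(1) by blast
  then have "(\<Inter>j\<in>J. B j) = {x \<in> space Q. \<forall>j\<in>J. Y j x \<in> A j}" using A(1) by auto
  moreover have "B j = {x \<in> space Q. Y j x \<in> A j}" if "j \<in> J" for j using A(1)[OF that] by auto
  ultimately show "Q.prob (\<Inter>j\<in>J. B j) = (\<Prod>j\<in>J. Q.prob (B j))"
    using prob_Y_product[OF J(3,2) A(2)] by simp
qed

lemma distr_Y:
  assumes "1 \<le> n"
  shows "distr Q process_algebra (Y n) = distr R process_algebra (excursion (ereal 0))"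
proof (rule measure_eqI)
  fix A assume "A \<in> sets (distr Q process_algebra (Y n))"
  then have A: "A \<in> sets process_algebra" by simp
  have e: "excursion (ereal 0) \<in> measurable R process_algebra"
    using measurable_excursion_one_sided by (simp cong: measurable_cong_sets add: sets_R)
  obtain m where "n = Suc m" using assms by (cases n) auto
  with law_Y[OF A, of m]
  show "emeasure (distr Q process_algebra (Y n)) A =
      emeasure (distr R process_algebra (excursion (ereal 0))) A"
    by (simp add: emeasure_distr[OF measurable_Y_Q A] emeasure_distr[OF e A]
        vimage_def Int_def conj_commute)
qed simp

end
end

theorem mainTheorem3:
  fixes Q R :: "config measure"
  assumes "prob_space Q" and "sets Q = sets two_sided_algebra"
    and "space_time_regenerative Q R"
    and "measure R {x \<in> space R. topological_space_class.discrete (snd x)} = 1"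
  shows "prob_space.indep_vars Q (\<lambda>_. process_algebra) Y {1..}
    \<and> (\<forall>m\<ge>1. \<forall>n\<ge>1. distr Q process_algebra (Y m) = distr Q process_algebra (Y n))"
  using indep_vars_Y[OF assms] distr_Y[OF assms] by simp

end
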